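(* Let $\mathfrak X$ be a category admitting arbitrary powers. Every contravariant functor $\varepsilon:\mathbf{Set}\to\mathfrak X$ sending coproducts to products is naturally equivalent to the contravariant functor $\mathcal B_K:\mathbf{Set}\to\mathfrak X$ for an appropriate object $K$ of $\mathfrak X$.
   Context: $\mathbf{Set}$ is the category of sets and maps. "Admitting arbitrary powers" means that for every object $K$ of $\mathfrak X$ and every set $X$ the product $K^X$ of $|X|$-many copies of $K$ exists in $\mathfrak X$; in particular $\mathfrak X$ has a terminal object (the empty power), and a fixed one is denoted $1$. For a non-empty set $X$ and $x\in X$, $\pi_x:K^X\to K$ denotes the canonical projection. For non-empty sets $X,Y$ and a map $\lambda:X\to Y$, the backward generalized shift $\sigma_\lambda:K^Y\to K^X$ is the unique morphism in $\mathfrak X$ with $\pi_x\circ\sigma_\lambda=\pi_{\lambda(x)}$ for every $x\in X$. The contravariant functor $\mathcal B_K:\mathbf{Set}\to\mathfrak X$ is defined by $\mathcal B_K(X)=K^X$ for $X\neq\emptyset$, $\mathcal B_K(\emptyset)=1$, $\mathcal B_K(\lambda)=\sigma_\lambda$ for $\lambda:X\to Y$ with $X,Y$ non-empty, and $\mathcal B_K(\lambda)$ equal to the unique morphism to $1$ when $X=\emptyset$. A contravariant functor $\varepsilon$ sends coproducts to products if for every family of sets $(X_i)_{i\in I}$ (including the empty family) with coproduct (disjoint union) $X$ and canonical maps $\iota_i:X_i\to X$, the object $\varepsilon(X)$ with the morphisms $\varepsilon(\iota_i):\varepsilon(X)\to\varepsilon(X_i)$ is a product of the family $(\varepsilon(X_i))_{i\in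 I}$ in $\mathfrak X$. *)

theory Defs
  imports "HOL-Library.FuncSet"
begin

section \<open>Categories\<close>

text \<open>A category need not be locally small: objects and arrows are arbitrary sets over the
  two types. \<open>Comp C g f\<close> is the composite \<open>g \<circ> f\<close> and is meaningful only if the
  codomain of \<open>f\<close> is the domain of \<open>g\<close>.\<close>

record ('o, 'm) cat =
  Obj :: "'o set"
  Arr :: "'m set"
  Dom :: "'m \<Rightarrow> 'o"
  Cod :: "'m \<Rightarrow> 'o"
  Ident :: "'o \<Rightarrow> 'm"
  Comp :: "'m \<Rightarrow> 'm \<Rightarrow> 'm"

definition Hom :: "('o, 'm) cat \<Rightarrow> 'o \<Rightarrow> 'o \<Rightarrow> 'm set" where
  "Hom C a b = {f \<in> Arr C. Dom C f = a \<and> Cod C f = b}"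

locale category =
  fixes C :: "('o, 'm) cat"
  assumes Dom_in_Obj: "f \<in> Arr C \<Longrightarrow> Dom C f \<in> Obj C"
    and Cod_in_Obj: "f \<in> Arr C \<Longrightarrow> Cod C f \<in> Obj C"
    and Ident_in_Hom: "a \<in> Obj C \<Longrightarrow> Ident C a \<in> Hom C a a"
    and Comp_in_Hom: "f \<in> Hom C a b \<Longrightarrow> g \<in> Hom C b c \<Longrightarrow> Comp C g f \<in> Hom C a c"
    and Comp_Ident: "f \<in> Hom C a b \<Longrightarrow> Comp C f (Ident C a) = f"
    and Ident_Comp: "f \<in> Hom C a b \<Longrightarrow> Comp C (Ident C b) f = f"
    and Comp_assoc: "f \<in> Hom C a b \<Longrightarrow> g \<in> Hom C b c \<Longrightarrow> h \<in> Hom C c d \<Longrightarrow>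
      Comp C h (Comp C g f) = Comp C (Comp C h g) f"

definition is_iso :: "('o, 'm) cat \<Rightarrow> 'o \<Rightarrow> 'o \<Rightarrow> 'm \<Rightarrow> bool" where
  "is_iso C a b f \<longleftrightarrow> f \<in> Hom C a b \<and>
    (\<exists>g \<in> Hom C b a. Comp C g f = Ident C a \<and> Comp C f g = Ident C b)"

definition is_terminal :: "('o, 'm) cat \<Rightarrow> 'o \<Rightarrow> bool" where
  "is_terminal C t \<longleftrightarrow> t \<in> Obj C \<and> (\<forall>a \<in> Obj C. \<exists>!h. h \<in> Hom C a t)"

definition is_product ::
  "('o, 'm) cat \<Rightarrow> 'i set \<Rightarrow> ('i \<Rightarrow> 'o) \<Rightarrow> 'o \<Rightarrow> ('i \<Rightarrow> 'm) \<Rightarrow> bool" where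
  "is_product C I F P p \<longleftrightarrow> P \<in> Obj C \<and> (\<forall>i \<in> I. p i \<in> Hom C P (F i)) \<and>
    (\<forall>Q \<in> Obj C. \<forall>q. (\<forall>i \<in> I. q i \<in> Hom C Q (F i)) \<longrightarrow>
      (\<exists>!h. h \<in> Hom C Q P \<and> (\<forall>i \<in> I. Comp C (p i) h = q i)))"

definition is_coproduct ::
  "('o, 'm) cat \<Rightarrow> 'i set \<Rightarrow> ('i \<Rightarrow> 'o) \<Rightarrow> 'o \<Rightarrow> ('i \<Rightarrow> 'm) \<Rightarrow> bool" where
  "is_coproduct C I F P p \<longleftrightarrow> P \<in> Obj C \<and> (\<forall>i \<in> I. p i \<in> Hom C (F i) P) \<and>
    (\<forall>Q \<in> Obj C. \<forall>q. (\<forall>i \<in> I. q i \<in> Hom C (F i) Q) \<longrightarrow>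
      (\<exists>!h. h \<in> Hom C P Q \<and> (\<forall>i \<in> I. Comp C h (p i) = q i)))"

section \<open>Contravariant functors\<close>

record ('o1, 'm1, 'o2, 'm2) fctr =
  OnObj :: "'o1 \<Rightarrow> 'o2"
  OnArr :: "'m1 \<Rightarrow> 'm2"

locale contravariant_functor = C: category C + D: category D
  for C :: "('o1, 'm1) cat" and D :: "('o2, 'm2) cat" +
  fixes F :: "('o1, 'm1, 'o2, 'm2) fctr"
  assumes OnObj_in_Obj: "a \<in> Obj C \<Longrightarrow> OnObj F a \<in> Obj D"
    and OnArr_in_Hom: "f \<in> Hom C a b \<Longrightarrow> OnArr F f \<in> Hom D (OnObj F b) (OnObj F a)"
    and OnArr_Ident: "a \<in> Obj C \<Longrightarrow> OnArr F (Ident C a) = Ident D (OnObj F a)"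
    and OnArr_Comp: "f \<in> Hom C a b \<Longrightarrow> g \<in> Hom C b c \<Longrightarrow>
      OnArr F (Comp C g f) = Comp D (OnArr F f) (OnArr F g)"

definition naturally_equivalent ::
  "('o1, 'm1) cat \<Rightarrow> ('o2, 'm2) cat \<Rightarrow> ('o1, 'm1, 'o2, 'm2) fctr \<Rightarrow>
    ('o1, 'm1, 'o2, 'm2) fctr \<Rightarrow> bool" where
  "naturally_equivalent C D F G \<longleftrightarrow>
    contravariant_functor C D F \<and> contravariant_functor C D G \<and>
    (\<exists>\<eta>. (\<forall>a \<in> Obj C. is_iso D (OnObj F a) (OnObj G a) (\<eta> a)) \<and>
         (\<forall>a b f. f \<in> Hom C a b \<longrightarrow>
            Comp D (\<eta> a) (OnArr F f) = Comp D (OnArr G f) (\<eta> b)))"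

section \<open>The category of sets\<close>

text \<open>HOL has no type of all sets, so the category of sets is taken relative to an arbitrary
  universe \<open>U\<close>: the members of \<open>U\<close> are the sets, and they are subject to the closure
  properties that ZFC provides, of which only those below are required. Any
  type carrying a model of ZFC gives such a universe, with all sets of the model as members
  (\<open>set_universe_ZFC\<close>). Because power sets are not required, universes also exist
  in plain HOL (\<open>set_universe_UNIV\<close>).\<close>

locale set_universe =
  fixes U :: "'u set set"
  assumes subset_closed: "X \<in> U \<Longrightarrow> Y \<subseteq> X \<Longrightarrow> Y \<in> U"
    and image_closed: "X \<in> U \<Longrightarrow> f ` X \<in> U"
    and Union_closed: "I \<in> U \<Longrightarrow> (\<And>i. i \<in> I \<Longrightarrow> F i \<in> U) \<Longrightarrow> (\<Union>i \<in> I. F i) \<in> U"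
    and infinite_member: "\<exists>X \<in> U. infinite X"

text \<open>An arrow is a triple (domain, map, codomain); the map is \<open>undefined\<close> off the
  domain, so that equality of arrows is equality of maps between sets.\<close>

definition SetCat :: "'u set set \<Rightarrow> ('u set, 'u set \<times> ('u \<Rightarrow> 'u) \<times> 'u set) cat" where
  "SetCat U = \<lparr>
    Obj = U,
    Arr = {(X, f, Y). X \<in> U \<and> Y \<in> U \<and> f \<in> X \<rightarrow>\<^sub>E Y},
    Dom = (\<lambda>(X, f, Y). X),
    Cod = (\<lambda>(X, f, Y). Y),
    Ident = (\<lambda>X. (X, \<lambda>x\<in>X. x, X)),
    Comp = (\<lambda>(Y', g, Z) (X, f, Y). (X, compose X g f, Z))\<rparr>"

lemma Hom_SetCat:
  "Hom (SetCat U) X Y = {(X, f, Y) | f. X \<in> U \<and> Y \<in> U \<and> f \<in> X \<rightarrow>\<^sub>E Y}"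
  by (auto simp: Hom_def SetCat_def)

lemma Comp_SetCat: "Comp (SetCat U) (Y', g, Z) (X, f, Y) = (X, compose X g f, Z)"
  by (simp add: SetCat_def)

lemma Ident_SetCat: "Ident (SetCat U) X = (X, \<lambda>x\<in>X. x, X)"
  by (simp add: SetCat_def)

lemma category_SetCat: "category (SetCat U)"
proof
  show "Dom (SetCat U) f \<in> Obj (SetCat U)" if "f \<in> Arr (SetCat U)" for f
    using that by (auto simp: SetCat_def)
  show "Cod (SetCat U) f \<in> Obj (SetCat U)" if "f \<in> Arr (SetCat U)" for f
    using that by (auto simp: SetCat_def)
  show "Ident (SetCat U) X \<in> Hom (SetCat U) X X" if "X \<in> Obj (SetCat U)" for X
    using that by (auto simp: Hom_def SetCat_def)
  fix f g X Y Z
  assume f: "f \<in> Hom (SetCat U) X Y"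
  then obtain f' where f': "f = (X, f', Y)" "X \<in> U" "Y \<in> U" "f' \<in> X \<rightarrow>\<^sub>E Y"
    by (auto simp: Hom_SetCat)
  have "compose X f' (\<lambda>x\<in>X. x) = f'" "compose X (\<lambda>x\<in>Y. x) f' = f'"
    using f'(4) by (auto simp: PiE_def intro: compose_Id Id_compose)
  then show "Comp (SetCat U) f (Ident (SetCat U) X) = f"
    and "Comp (SetCat U) (Ident (SetCat U) Y) f = f"
    by (simp_all add: f'(1) Comp_SetCat Ident_SetCat)
  assume g: "g \<in> Hom (SetCat U) Y Z"
  then obtain g' where g': "g = (Y, g', Z)" "Z \<in> U" "g' \<in> Y \<rightarrow>\<^sub>E Z"
    by (auto simp: Hom_SetCat)
  have "compose X g' f' \<in> X \<rightarrow>\<^sub>E Z"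
    using f'(4) g'(3) by (auto simp: PiE_def compose_def)
  then show "Comp (SetCat U) g f \<in> Hom (SetCat U) X Z"
    using f' g' by (simp add: Comp_SetCat Hom_SetCat)
  fix h W
  assume "h \<in> Hom (SetCat U) Z W"
  then obtain h' where h': "h = (Z, h', W)"
    by (auto simp: Hom_SetCat)
  have "compose X h' (compose X g' f') = compose X (compose Y h' g') f'"
    using f'(4) by (intro compose_assoc) (auto simp: PiE_def)
  then show "Comp (SetCat U) h (Comp (SetCat U) g f) = Comp (SetCat U) (Comp (SetCat U) h g) f"
    by (simp add: f'(1) g'(1) h' Comp_SetCat)
qed

text \<open>The assumptions are separation, union, replacement and infinity for a type \<open>'v\<close> of
  sets with element function \<open>elts\<close>.\<close>

lemma set_universe_ZFC:
  fixes elts :: "'v \<Rightarrow> 'v set"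
  assumes "\<And>x Y. Y \<subseteq> elts x \<Longrightarrow> Y \<in> range elts"
    and "\<And>x. \<Union> (elts ` elts x) \<in> range elts"
    and "\<And>x f. f ` elts x \<in> range elts"
    and "\<exists>x. infinite (elts x)"
  shows "set_universe (range elts)"
proof
  fix I and F :: "'v \<Rightarrow> 'v set"
  assume I: "I \<in> range elts" and F: "\<And>i. i \<in> I \<Longrightarrow> F i \<in> range elts"
  obtain x where x: "I = elts x"
    using I by (rule rangeE)
  define g where "g i = (SOME y. F i = elts y)" for i
  have g: "F i = elts (g i)" if "i \<in> I" for i
    unfolding g_def by (rule someI_ex) (use F[OF that] in \<open>simp add: image_iff\<close>)
  obtain y where y: "g ` I = elts y"
    unfolding x by (rule rangeE[OF assms(3)])
  have "(\<Union>i \<in> I. F i) = (\<Union>i \<in> I. elts (g i))"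
    using g by (intro SUP_cong) simp_all
  also have "\<dots> = \<Union> (elts ` elts y)"
    by (simp only: y[symmetric] image_image)
  finally show "(\<Union>i \<in> I. F i) \<in> range elts"
    by (simp only: assms(2))
next
  fix X Y
  assume "X \<in> range elts" "Y \<subseteq> X"
  then obtain x where "Y \<subseteq> elts x"
    by blast
  then show "Y \<in> range elts"
    by (rule assms(1))
next
  fix X and f :: "'v \<Rightarrow> 'v"
  assume "X \<in> range elts"
  then obtain x where "X = elts x"
    by blast
  then show "f ` X \<in> range elts"
    by (simp only: assms(3))
next
  obtain x where "infinite (elts x)"
    using assms(4) ..
  then show "\<exists>X \<in> range elts. infinite X"
    by blast
qed

lemma set_universe_UNIV: "infinite (UNIV :: 'u set) \<Longrightarrow> set_universe (UNIV :: 'u set set)"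
  by standard auto

text \<open>Coproducts are defined by their universal property; disjoint unions have it, and every
  family of sets indexed by a set has a disjoint union in the universe.\<close>

lemma disjoint_union_is_coproduct:
  assumes P: "P \<in> U" and F: "\<And>i. i \<in> I \<Longrightarrow> F i \<in> U"
    and maps: "\<And>i. i \<in> I \<Longrightarrow> j i \<in> F i \<rightarrow>\<^sub>E P"
    and inj: "\<And>i. i \<in> I \<Longrightarrow> inj_on (j i) (F i)"
    and disj: "\<And>i k. i \<in> I \<Longrightarrow> k \<in> I \<Longrightarrow> i \<noteq> k \<Longrightarrow> j i ` F i \<inter> j k ` F k = {}"
    and cover: "P = (\<Union>i \<in> I. j i ` F i)"
  shows "is_coproduct (SetCat U) I F P (\<lambda>i. (F i, j i, P))"
  unfolding is_coproduct_def
proof (intro conjI ballI allI impI)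
  show "P \<in> Obj (SetCat U)"
    using P by (simp add: SetCat_def)
  show "(F i, j i, P) \<in> Hom (SetCat U) (F i) P" if "i \<in> I" for i
    using that P F maps by (auto simp: Hom_SetCat)
  fix Q q
  assume Q: "Q \<in> Obj (SetCat U)" and q: "\<forall>i \<in> I. q i \<in> Hom (SetCat U) (F i) Q"
  define r where "r i = fst (snd (q i))" for i
  have qr: "q i = (F i, r i, Q)" and r: "r i \<in> F i \<rightarrow>\<^sub>E Q" if "i \<in> I" for i
    using bspec[OF q that] by (auto simp: Hom_SetCat r_def)
  have uniq: "i = k \<and> x = y"
    if "i \<in> I" "k \<in> I" "x \<in> F i" "y \<in> F k" "j i x = j k y" for i k x y
    using that disj[of i k] inj[of i] by (cases "i = k") (auto dest: inj_onD)
  have "\<exists>z. \<forall>i x. i \<in> I \<longrightarrow> x \<in> F i \<longrightarrow> p = j i x \<longrightarrow> z = r i x" for p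
  proof (cases "\<exists>i x. i \<in> I \<and> x \<in> F i \<and> p = j i x")
    case True
    then obtain i x where "i \<in> I" "x \<in> F i" "p = j i x"
      by blast
    then show ?thesis
      by (intro exI[of _ "r i x"]) (use uniq in blast)
  qed blast
  then obtain h where h: "\<And>i x. i \<in> I \<Longrightarrow> x \<in> F i \<Longrightarrow> h (j i x) = r i x"
    by metis
  show "\<exists>!g. g \<in> Hom (SetCat U) P Q \<and> (\<forall>i \<in> I. Comp (SetCat U) g (F i, j i, P) = q i)"
  proof (rule ex1I)
    have "restrict h P \<in> P \<rightarrow>\<^sub>E Q"
      using r h by (fastforce simp: cover)
    moreover have "compose (F i) (restrict h P) (j i) = r i" if "i \<in> I" for i
    proof
      show "compose (F i) (restrict h P) (j i) x = r i x" for x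
        using that h[of i x] r[of i] maps[of i]
        by (auto simp: compose_def PiE_iff extensional_def)
    qed
    ultimately show "(P, restrict h P, Q) \<in> Hom (SetCat U) P Q \<and>
      (\<forall>i \<in> I. Comp (SetCat U) (P, restrict h P, Q) (F i, j i, P) = q i)"
      using P Q qr by (auto simp: Hom_SetCat) (auto simp: SetCat_def)
  next
    fix g
    assume g: "g \<in> Hom (SetCat U) P Q \<and> (\<forall>i \<in> I. Comp (SetCat U) g (F i, j i, P) = q i)"
    then obtain k where gk: "g = (P, k, Q)" and k: "k \<in> P \<rightarrow>\<^sub>E Q"
      by (auto simp: Hom_SetCat)
    have "compose (F i) k (j i) = r i" if "i \<in> I" for i
      using g gk qr[OF that] that by (auto simp: SetCat_def)
    then have "k (j i x) = h (j i x)" if "i \<in> I" "x \<in> F i" for i x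
      using that h by (metis compose_eq)
    then have "k p = restrict h P p" for p
      using k by (cases "p \<in> P") (auto simp: cover PiE_iff extensional_def)
    then show "g = (P, restrict h P, Q)"
      using gk by auto
  qed
qed

lemma (in set_universe) ex_coproduct:
  assumes I: "I \<in> U" and F: "\<And>i. i \<in> I \<Longrightarrow> F i \<in> U"
  shows "\<exists>P \<iota>. is_coproduct (SetCat U) I F P \<iota>"
proof -
  obtain W where W: "W \<in> U" "infinite W"
    using infinite_member by blast
  obtain a where "a \<in> W"
    using infinite_imp_nonempty[OF W(2)] by blast
  obtain b where "b \<in> W - {a}"
    using infinite_imp_nonempty[OF infinite_remove[OF W(2)]] by blast
  have Un: "S \<union> T \<in> U" if "S \<in> U" "T \<in> U" for S T
  proof -
    have "(\<Union>i \<in> {a, b}. if i = a then S else T) \<in> U"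
      using that subset_closed[OF W(1), of "{a, b}"] \<open>a \<in> W\<close> \<open>b \<in> W - {a}\<close>
      by (intro Union_closed) auto
    then show ?thesis
      using \<open>b \<in> W - {a}\<close> by (auto split: if_splits)
  qed
  define Z where "Z = (I \<union> (\<Union>i \<in> I. F i)) \<union> W"
  have Z: "Z \<in> U"
    unfolding Z_def using I F W by (intro Un Union_closed)
  have "infinite Z"
    using W by (simp add: Z_def)
  then obtain f where f: "bij_betw f (Z \<times> Z) Z"
    using card_of_Times_same_infinite card_of_ordIso by blast
  define j where "j i = (\<lambda>x \<in> F i. f (i, x))" for i
  define P where "P = (\<Union>i \<in> I. j i ` F i)"
  have mem: "(i, x) \<in> Z \<times> Z" if "i \<in> I" "x \<in> F i" for i x
    using that by (auto simp: Z_def)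
  have finj: "i = k \<and> x = y"
    if "i \<in> I" "k \<in> I" "x \<in> F i" "y \<in> F k" "f (i, x) = f (k, y)" for i k x y
    using inj_onD[OF bij_betw_imp_inj_on[OF f] that(5)] mem that by blast
  have "P \<subseteq> Z"
    using f mem by (auto simp: P_def j_def bij_betw_def)
  then have "P \<in> U"
    using Z subset_closed by blast
  then have "is_coproduct (SetCat U) I F P (\<lambda>i. (F i, j i, P))"
    using F
  proof (rule disjoint_union_is_coproduct)
    show "j i \<in> F i \<rightarrow>\<^sub>E P" if "i \<in> I" for i
      using that by (auto simp: P_def j_def)
    show "inj_on (j i) (F i)" if "i \<in> I" for i
      using that finj by (auto simp: j_def inj_on_def)
    show "j i ` F i \<inter> j k ` F k = {}" if "i \<in> I" "k \<in> I" "i \<noteq> k" for i k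
      using that finj by (auto simp: j_def)
  qed (simp_all add: P_def)
  then show ?thesis
    by blast
qed

section \<open>Powers and backward generalized shifts\<close>

definition admits_powers :: "'u set set \<Rightarrow> ('o, 'm) cat \<Rightarrow> bool" where
  "admits_powers U C \<longleftrightarrow>
    (\<forall>K \<in> Obj C. \<forall>X \<in> U. \<exists>P p. is_product C X (\<lambda>_. K) P p)"

definition one :: "('o, 'm) cat \<Rightarrow> 'o" where
  "one C = (SOME t. is_terminal C t)"

definition to_one :: "('o, 'm) cat \<Rightarrow> 'o \<Rightarrow> 'm" where
  "to_one C a = (THE h. h \<in> Hom C a (one C))"

text \<open>A fixed choice of the power of \<open>K\<close> with exponent \<open>X\<close>, with its projections.\<close>

definition power_cone :: "('o, 'm) cat \<Rightarrow> 'o \<Rightarrow> 'u set \<Rightarrow> 'o \<times> ('u \<Rightarrow> 'm)" where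
  "power_cone C K X = (SOME (P, p). is_product C X (\<lambda>_. K) P p)"

definition power_obj :: "('o, 'm) cat \<Rightarrow> 'o \<Rightarrow> 'u set \<Rightarrow> 'o" where
  "power_obj C K X = fst (power_cone C K X)"

definition power_proj :: "('o, 'm) cat \<Rightarrow> 'o \<Rightarrow> 'u set \<Rightarrow> 'u \<Rightarrow> 'm" where
  "power_proj C K X = snd (power_cone C K X)"

definition gen_shift ::
  "('o, 'm) cat \<Rightarrow> 'o \<Rightarrow> 'u set \<Rightarrow> 'u set \<Rightarrow> ('u \<Rightarrow> 'u) \<Rightarrow> 'm" where
  "gen_shift C K X Y l = (THE s. s \<in> Hom C (power_obj C K Y) (power_obj C K X) \<and>
    (\<forall>x \<in> X. Comp C (power_proj C K X x) s = power_proj C K Y (l x)))"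

definition BK_obj :: "('o, 'm) cat \<Rightarrow> 'o \<Rightarrow> 'u set \<Rightarrow> 'o" where
  "BK_obj C K X = (if X = {} then one C else power_obj C K X)"

definition BK ::
  "('o, 'm) cat \<Rightarrow> 'o \<Rightarrow> ('u set, 'u set \<times> ('u \<Rightarrow> 'u) \<times> 'u set, 'o, 'm) fctr" where
  "BK C K = \<lparr>
    OnObj = BK_obj C K,
    OnArr = (\<lambda>(X, l, Y).
      if X = {} then to_one C (BK_obj C K Y) else gen_shift C K X Y l)\<rparr>"

definition coproducts_to_products ::
  "'u set set \<Rightarrow> ('o, 'm) cat \<Rightarrow>
    ('u set, 'u set \<times> ('u \<Rightarrow> 'u) \<times> 'u set, 'o, 'm) fctr \<Rightarrow> bool" where
  "coproducts_to_products U C F \<longleftrightarrow>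
    (\<forall>I \<in> U. \<forall>X P \<iota>. is_coproduct (SetCat U) I X P \<iota> \<longrightarrow>
      is_product C I (\<lambda>i. OnObj F (X i)) (OnObj F P) (\<lambda>i. OnArr F (\<iota> i)))"

end

theory Submission
  imports Defs
begin

text \<open>Every set \<open>X\<close> is the coproduct of \<open>X\<close>-many copies of a fixed singleton \<open>S\<close>, along the
  maps \<open>S \<rightarrow> X\<close> picking out the elements of \<open>X\<close>. Hence \<open>\<epsilon> X\<close> and \<open>\<B>\<^sub>K X\<close> are both \<open>X\<close>-fold powers
  of \<open>K = \<epsilon> S\<close>, and the comparison isomorphism is natural because both functors send
  \<open>l : X \<rightarrow> Y\<close> to the arrow whose component at \<open>x\<close> is the projection at \<open>l x\<close>.\<close>

section \<open>Products\<close>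

lemma is_product_Obj: "is_product C I F P p \<Longrightarrow> P \<in> Obj C"
  and is_product_proj: "is_product C I F P p \<Longrightarrow> i \<in> I \<Longrightarrow> p i \<in> Hom C P (F i)"
  by (simp_all add: is_product_def)

lemma is_product_ex1:
  assumes "is_product C I F P p" "Q \<in> Obj C" "\<And>i. i \<in> I \<Longrightarrow> q i \<in> Hom C Q (F i)"
  shows "\<exists>!h. h \<in> Hom C Q P \<and> (\<forall>i \<in> I. Comp C (p i) h = q i)"
  using assms by (simp add: is_product_def)

text \<open>With no indices, the cone conditions are vacuous and the universal property leaves just
  one arrow from each object. This lets the value \<open>one C\<close> at the empty set be handled
  as an empty power.\<close>

lemma is_product_empty_iff_terminal: "is_product C {} F P p \<longleftrightarrow> is_terminal C P"
  by (simp add: is_product_def is_terminal_def)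

context category
begin

text \<open>Both arrows factor the cone obtained by composing the projections with \<open>h\<close>,
  and such a factorization is unique. The functor laws for \<open>BK\<close> and naturality are
  proved by this cancellation.\<close>

lemma product_arrow_eqI:
  assumes "is_product C I F P p" "g \<in> Hom C Q P" "h \<in> Hom C Q P"
    and "\<And>i. i \<in> I \<Longrightarrow> Comp C (p i) g = Comp C (p i) h"
  shows "g = h"
proof -
  have "Q \<in> Obj C"
    using assms(2) Dom_in_Obj by (auto simp: Hom_def)
  then have "\<exists>!k. k \<in> Hom C Q P \<and> (\<forall>i \<in> I. Comp C (p i) k = Comp C (p i) h)"
    using assms(1,3) by (intro is_product_ex1) (auto intro: Comp_in_Hom dest: is_product_proj)
  then show ?thesis
    using assms(2-4) by blast
qed

text \<open>Each cone factors through the other, and both round trips fix all projections.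
  Compatibility with the projections is recorded because naturality is later derived from
  it.\<close>

lemma product_unique_iso:
  assumes P: "is_product C I F P p" and Q: "is_product C I F Q q"
  shows "\<exists>h. is_iso C P Q h \<and> (\<forall>i \<in> I. Comp C (q i) h = p i)"
proof -
  obtain h where h: "h \<in> Hom C P Q" "\<And>i. i \<in> I \<Longrightarrow> Comp C (q i) h = p i"
    using is_product_ex1[OF Q is_product_Obj[OF P] is_product_proj[OF P]] by blast
  obtain k where k: "k \<in> Hom C Q P" "\<And>i. i \<in> I \<Longrightarrow> Comp C (p i) k = q i"
    using is_product_ex1[OF P is_product_Obj[OF Q] is_product_proj[OF Q]] by blast
  have "Comp C k h = Ident C P"
  proof (rule product_arrow_eqI[OF P])
    show "Comp C k h \<in> Hom C P P" "Ident C P \<in> Hom C P P"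
      using h k P by (auto intro: Comp_in_Hom Ident_in_Hom is_product_Obj)
    show "Comp C (p i) (Comp C k h) = Comp C (p i) (Ident C P)" if "i \<in> I" for i
      using Comp_assoc[OF h(1) k(1) is_product_proj[OF P that]]
        Comp_Ident[OF is_product_proj[OF P that]] h(2) k(2) that by simp
  qed
  moreover have "Comp C h k = Ident C Q"
  proof (rule product_arrow_eqI[OF Q])
    show "Comp C h k \<in> Hom C Q Q" "Ident C Q \<in> Hom C Q Q"
      using h k Q by (auto intro: Comp_in_Hom Ident_in_Hom is_product_Obj)
    show "Comp C (q i) (Comp C h k) = Comp C (q i) (Ident C Q)" if "i \<in> I" for i
      using Comp_assoc[OF k(1) h(1) is_product_proj[OF Q that]]
        Comp_Ident[OF is_product_proj[OF Q that]] h(2) k(2) that by simp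
  qed
  ultimately show ?thesis
    using h k by (auto simp: is_iso_def)
qed

end

section \<open>The functor of powers\<close>

lemma power_obj_is_product:
  assumes "admits_powers U C" "K \<in> Obj C" "X \<in> U"
  shows "is_product C X (\<lambda>_. K) (power_obj C K X) (power_proj C K X)"
proof -
  have "\<exists>c. case c of (P, p) \<Rightarrow> is_product C X (\<lambda>_. K) P p"
    using assms by (auto simp: admits_powers_def)
  then have "case power_cone C K X of (P, p) \<Rightarrow> is_product C X (\<lambda>_. K) P p"
    unfolding power_cone_def by (rule someI_ex)
  then show ?thesis
    by (simp add: power_obj_def power_proj_def split_beta)
qed

lemma BK_obj_is_product:
  assumes "admits_powers U C" "K \<in> Obj C" "X \<in> U"
  shows "is_product C X (\<lambda>_. K) (BK_obj C K X) (power_proj C K X)"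
proof (cases "X = {}")
  case True
  \<comment> \<open>The empty power of \<open>K\<close> witnesses that the choice defining
    \<open>one C\<close> is a choice among existing terminal objects.\<close>
  then have "is_terminal C (power_obj C K X)"
    using power_obj_is_product[OF assms] is_product_empty_iff_terminal by metis
  then have "is_terminal C (one C)"
    unfolding one_def by (rule someI)
  then show ?thesis
    using True by (simp add: BK_obj_def is_product_empty_iff_terminal)
qed (simp add: BK_obj_def power_obj_is_product[OF assms])

text \<open>Both clauses of \<open>OnArr (BK C K)\<close> are instances of one definite description:
  for empty \<open>X\<close> the projection equations are vacuous and it becomes
  \<open>to_one\<close>. Later proofs therefore need no case split on emptiness.\<close>

lemma BK_arr:
  assumes pow: "admits_powers U C" and K: "K \<in> Obj C"
    and X: "X \<in> U" and Y: "Y \<in> U" and l: "l \<in> X \<rightarrow> Y"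
  shows BK_arr_in_Hom:
      "OnArr (BK C K) (X, l, Y) \<in> Hom C (BK_obj C K Y) (BK_obj C K X)" (is "?s \<in> ?H")
    and BK_arr_proj: "x \<in> X \<Longrightarrow>
      Comp C (power_proj C K X x) (OnArr (BK C K) (X, l, Y)) = power_proj C K Y (l x)"
proof -
  note pX = BK_obj_is_product[OF pow K X] and pY = BK_obj_is_product[OF pow K Y]
  let ?P = "\<lambda>s. s \<in> ?H \<and> (\<forall>x \<in> X. Comp C (power_proj C K X x) s = power_proj C K Y (l x))"
  have ex1: "\<exists>!s. ?P s"
    using l by (intro is_product_ex1[OF pX is_product_Obj[OF pY]]) (auto intro: is_product_proj[OF pY])
  have eq: "?s = (THE s. ?P s)"
  proof (cases "X = {}")
    case False
    \<comment> \<open>A map out of a non-empty set has a non-empty codomain, so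
      \<open>BK_obj\<close> agrees with the \<open>power_obj\<close> in \<open>gen_shift\<close> at
      both ends.\<close>
    then have "Y \<noteq> {}"
      using l by auto
    then show ?thesis
      using False by (simp add: BK_def gen_shift_def BK_obj_def)
  qed (simp add: BK_def to_one_def BK_obj_def)
  have "?P ?s"
    unfolding eq by (rule theI'[OF ex1])
  then show "?s \<in> ?H"
    and "x \<in> X \<Longrightarrow> Comp C (power_proj C K X x) ?s = power_proj C K Y (l x)"
    by blast+
qed

text \<open>Both functor laws are checked on projections: the identity keeps the index
  \<open>x\<close>, and shifting along \<open>l\<close> and then \<open>m\<close> turns it into
  \<open>m (l x)\<close>.\<close>

lemma contravariant_functor_BK:
  assumes "category C" and pow: "admits_powers U C" and K: "K \<in> Obj C"
  shows "contravariant_functor (SetCat U) C (BK C K)"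
proof -
  interpret category C by fact
  interpret S: category "SetCat U" by (rule category_SetCat)
  note prod = BK_obj_is_product[OF pow K] and hom = BK_arr_in_Hom[OF pow K]
    and proj = BK_arr_proj[OF pow K]
  have Obj: "OnObj (BK C K) = BK_obj C K"
    by (simp add: BK_def)
  show ?thesis
  proof
    show "OnObj (BK C K) X \<in> Obj C" if "X \<in> Obj (SetCat U)" for X
      using that is_product_Obj[OF prod] by (simp add: Obj SetCat_def)
    show "OnArr (BK C K) f \<in> Hom C (OnObj (BK C K) Y) (OnObj (BK C K) X)"
      if "f \<in> Hom (SetCat U) X Y" for f X Y
      using that hom by (auto simp: Obj Hom_SetCat PiE_def)
    show "OnArr (BK C K) (Ident (SetCat U) X) = Ident C (OnObj (BK C K) X)"
      if "X \<in> Obj (SetCat U)" for X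
    proof -
      have X: "X \<in> U"
        using that by (simp add: SetCat_def)
      show ?thesis
        unfolding Obj Ident_SetCat
      proof (rule product_arrow_eqI[OF prod[OF X]])
        show "OnArr (BK C K) (X, \<lambda>x\<in>X. x, X) \<in> Hom C (BK_obj C K X) (BK_obj C K X)"
          using X by (intro hom) auto
        show "Ident C (BK_obj C K X) \<in> Hom C (BK_obj C K X) (BK_obj C K X)"
          by (rule Ident_in_Hom[OF is_product_Obj[OF prod[OF X]]])
        show "Comp C (power_proj C K X x) (OnArr (BK C K) (X, \<lambda>x\<in>X. x, X)) =
            Comp C (power_proj C K X x) (Ident C (BK_obj C K X))" if "x \<in> X" for x
          using proj[OF X X _ that, of "\<lambda>x\<in>X. x"] that
            Comp_Ident[OF is_product_proj[OF prod[OF X] that]] by simp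
      qed
    qed
    show "OnArr (BK C K) (Comp (SetCat U) g f) =
        Comp C (OnArr (BK C K) f) (OnArr (BK C K) g)"
      if f: "f \<in> Hom (SetCat U) X Y" and g: "g \<in> Hom (SetCat U) Y Z" for f g X Y Z
    proof -
      obtain l m where f: "f = (X, l, Y)" and g: "g = (Y, m, Z)"
        and X: "X \<in> U" and Y: "Y \<in> U" and Z: "Z \<in> U" and l: "l \<in> X \<rightarrow> Y" and m: "m \<in> Y \<rightarrow> Z"
        using f g by (auto simp: Hom_SetCat PiE_def)
      have ml: "compose X m l \<in> X \<rightarrow> Z"
        using l m by (auto simp: compose_def)
      note hl = hom[OF X Y l] and hm = hom[OF Y Z m]
      show ?thesis
        unfolding f g Comp_SetCat
      proof (rule product_arrow_eqI[OF prod[OF X]])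
        show "OnArr (BK C K) (X, compose X m l, Z) \<in> Hom C (BK_obj C K Z) (BK_obj C K X)"
          by (rule hom[OF X Z ml])
        show "Comp C (OnArr (BK C K) (X, l, Y)) (OnArr (BK C K) (Y, m, Z))
            \<in> Hom C (BK_obj C K Z) (BK_obj C K X)"
          by (rule Comp_in_Hom[OF hm hl])
        show "Comp C (power_proj C K X x) (OnArr (BK C K) (X, compose X m l, Z)) =
            Comp C (power_proj C K X x)
              (Comp C (OnArr (BK C K) (X, l, Y)) (OnArr (BK C K) (Y, m, Z)))" if x: "x \<in> X" for x
          using proj[OF X Z ml x] proj[OF X Y l x] proj[OF Y Z m funcset_mem[OF l x]] x
            Comp_assoc[OF hm hl is_product_proj[OF prod[OF X] x]]
          by (simp add: compose_eq)
      qed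
    qed
  qed
qed

section \<open>Sets as coproducts of points\<close>

definition point :: "'u \<Rightarrow> 'u set \<Rightarrow> 'u \<Rightarrow> 'u set \<times> ('u \<Rightarrow> 'u) \<times> 'u set" where
  "point s X x = ({s}, \<lambda>_ \<in> {s}. x, X)"

lemma point_in_Hom: "{s} \<in> U \<Longrightarrow> X \<in> U \<Longrightarrow> x \<in> X \<Longrightarrow> point s X x \<in> Hom (SetCat U) {s} X"
  by (auto simp: point_def Hom_SetCat)

text \<open>Applying a contravariant functor to this equation yields the defining property of a
  shift, which is the source of naturality.\<close>

lemma Comp_point: "Comp (SetCat U) (X, l, Y) (point s X x) = point s Y (l x)"
  by (auto simp: point_def Comp_SetCat compose_def)

text \<open>The injections have singleton domains, and their images are the sets \<open>{x}\<close>,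
  which partition \<open>X\<close>.\<close>

lemma is_coproduct_points:
  assumes "{s} \<in> U" "X \<in> U"
  shows "is_coproduct (SetCat U) X (\<lambda>_. {s}) X (point s X)"
proof -
  have "is_coproduct (SetCat U) X (\<lambda>_. {s}) X (\<lambda>x. ({s}, \<lambda>_ \<in> {s}. x, X))"
    using assms by (intro disjoint_union_is_coproduct) auto
  then show ?thesis
    by (simp add: point_def[abs_def])
qed

theorem theorem4p15:
  fixes U :: "'u set set"
    and C :: "('o, 'm) cat"
    and \<epsilon> :: "('u set, 'u set \<times> ('u \<Rightarrow> 'u) \<times> 'u set, 'o, 'm) fctr"
  assumes "set_universe U"
    and "category C"
    and "admits_powers U C"
    and "contravariant_functor (SetCat U) C \<epsilon>"
    and "coproducts_to_products U C \<epsilon>"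
  shows "\<exists>K \<in> Obj C. naturally_equivalent (SetCat U) C \<epsilon> (BK C K)"
proof -
  interpret set_universe U by fact
  interpret category C by fact
  interpret \<epsilon>: contravariant_functor "SetCat U" C \<epsilon> by fact
  \<comment> \<open>The infinite member supplies an element, and closure under subsets then puts its
    singleton into the universe.\<close>
  obtain W s where "W \<in> U" "s \<in> W"
    using infinite_member infinite_imp_nonempty by blast
  then have s: "{s} \<in> U"
    by (auto intro: subset_closed)
  define K where "K = OnObj \<epsilon> {s}"
  have K: "K \<in> Obj C"
    using s unfolding K_def by (intro \<epsilon>.OnObj_in_Obj) (simp add: SetCat_def)
  note BK = contravariant_functor_BK[OF assms(2,3) K]
  note prod = BK_obj_is_product[OF assms(3) K]
  have \<epsilon>prod: "is_product C X (\<lambda>_. K) (OnObj \<epsilon> X) (\<lambda>x. OnArr \<epsilon> (point s X x))" if "X \<in> U" for X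
    using assms(5) is_coproduct_points[OF s that] that
    by (auto simp: coproducts_to_products_def K_def)
  have "\<exists>h. is_iso C (OnObj \<epsilon> X) (BK_obj C K X) h \<and>
      (\<forall>x \<in> X. Comp C (power_proj C K X x) h = OnArr \<epsilon> (point s X x))" if "X \<in> U" for X
    by (rule product_unique_iso[OF \<epsilon>prod[OF that] prod[OF that]])
  \<comment> \<open>The isomorphisms are chosen independently for each set; the projection equations
    \<open>\<eta>\<close> are what ties them together.\<close>
  then obtain \<eta> where iso: "\<And>X. X \<in> U \<Longrightarrow> is_iso C (OnObj \<epsilon> X) (BK_obj C K X) (\<eta> X)"
    and \<eta>: "\<And>X x. X \<in> U \<Longrightarrow> x \<in> X \<Longrightarrow>
      Comp C (power_proj C K X x) (\<eta> X) = OnArr \<epsilon> (point s X x)"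
    by metis
  have \<eta>_Hom: "\<eta> X \<in> Hom C (OnObj \<epsilon> X) (BK_obj C K X)" if "X \<in> U" for X
    using iso[OF that] by (simp add: is_iso_def)
  have natural: "Comp C (\<eta> X) (OnArr \<epsilon> f) = Comp C (OnArr (BK C K) f) (\<eta> Y)"
    if f: "f \<in> Hom (SetCat U) X Y" for X Y f
  proof -
    obtain l where fl: "f = (X, l, Y)" and X: "X \<in> U" and Y: "Y \<in> U" and l: "l \<in> X \<rightarrow> Y"
      using f by (auto simp: Hom_SetCat PiE_def)
    note \<epsilon>f = \<epsilon>.OnArr_in_Hom[OF f]
    have Bf: "OnArr (BK C K) f \<in> Hom C (BK_obj C K Y) (BK_obj C K X)"
      unfolding fl by (rule BK_arr_in_Hom[OF assms(3) K X Y l])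
    show ?thesis
    proof (rule product_arrow_eqI[OF prod[OF X]])
      show "Comp C (\<eta> X) (OnArr \<epsilon> f) \<in> Hom C (OnObj \<epsilon> Y) (BK_obj C K X)"
        by (rule Comp_in_Hom[OF \<epsilon>f \<eta>_Hom[OF X]])
      show "Comp C (OnArr (BK C K) f) (\<eta> Y) \<in> Hom C (OnObj \<epsilon> Y) (BK_obj C K X)"
        by (rule Comp_in_Hom[OF \<eta>_Hom[OF Y] Bf])
      fix x assume x: "x \<in> X"
      then have lx: "l x \<in> Y"
        using l by auto
      note p = is_product_proj[OF prod[OF X] x]
      \<comment> \<open>Both sides of the naturality square project at \<open>x\<close> to
        \<open>\<epsilon>\<close> of the point \<open>l x\<close>: here by contravariance of
        \<open>\<epsilon>\<close>, on the other side because the shift replaces the projection at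
        \<open>x\<close> by the one at \<open>l x\<close>.\<close>
      have "Comp C (power_proj C K X x) (Comp C (\<eta> X) (OnArr \<epsilon> f)) =
          Comp C (OnArr \<epsilon> (point s X x)) (OnArr \<epsilon> f)"
        using Comp_assoc[OF \<epsilon>f \<eta>_Hom[OF X] p] \<eta>[OF X x] by simp
      also have "\<dots> = OnArr \<epsilon> (point s Y (l x))"
        using \<epsilon>.OnArr_Comp[OF point_in_Hom[OF s X x] f] by (simp add: fl Comp_point)
      also have "\<dots> = Comp C (power_proj C K X x) (Comp C (OnArr (BK C K) f) (\<eta> Y))"
        using Comp_assoc[OF \<eta>_Hom[OF Y] Bf p] \<eta>[OF Y lx]
          BK_arr_proj[OF assms(3) K X Y l x] by (simp add: fl)
      finally show "Comp C (power_proj C K X x) (Comp C (\<eta> X) (OnArr \<epsilon> f)) =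
          Comp C (power_proj C K X x) (Comp C (OnArr (BK C K) f) (\<eta> Y))" .
    qed
  qed
  have "naturally_equivalent (SetCat U) C \<epsilon> (BK C K)"
    unfolding naturally_equivalent_def
  proof (intro conjI exI[of _ \<eta>] ballI allI impI)
    show "is_iso C (OnObj \<epsilon> X) (OnObj (BK C K) X) (\<eta> X)" if "X \<in> Obj (SetCat U)" for X
      using iso that by (simp add: BK_def SetCat_def)
  qed (fact assms(4) BK | erule natural)+
  then show ?thesis
    using K by blast
qed

end
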